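(* Let $\sigma:\mathbb{R}\to\mathbb{R}$ be monotone and $\tilde L_\sigma$-Lipschitz in the sense that $0\le \frac{\sigma(a)-\sigma(b)}{a-b}\le \tilde L_\sigma$ for all $a,b\in\mathbb{R}$ with $a\ne b$. Let $\mathbf W\in\mathbb{R}^{n\times m}$, $\mathbf U\in\mathbb{R}^{n\times d}$, $\mathbf b\in\mathbb{R}^n$, $\mathbf x\in\mathbb{R}^d$, let $\mu>0$ be a real number, and define $f:\mathbb{R}^m\to\mathbb{R}^m$ by $$f(\mathbf z)=\frac1\mu \mathbf W^\top\sigma(\mathbf W\mathbf z+\mathbf U\mathbf x+\mathbf b).$$ Define $$\psi(\mathbf z)=\frac1\mu \mathbf 1^\top\tilde\sigma(\mathbf W\mathbf z+\mathbf U\mathbf x+\mathbf b),\qquad \varphi(\mathbf z)=\psi^*(\mathbf z)-\frac12\|\mathbf z\|^2 .$$ If $\mu\ge\tilde L_\sigma\|\mathbf W\|_2^2$, then $f(\mathbf z)=\operatorname{prox}_\varphi(\mathbf z)$ for all $\mathbf z\in\mathbb{R}^m$. Furthermore, $\varphi$ is convex and any solution of the fixed point equation $\mathbf z=f(\mathbf z)$ is a minimizer of $\varphi$.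
   Context: $\sigma$ is applied element-wise to vectors. $\tilde\sigma(a)=\int_0^a\sigma(t)\,dt$ for $a\in\mathbb{R}$, also applied element-wise to vectors, and $\mathbf 1\in\mathbb{R}^n$ is the all-one vector. $\|\cdot\|$ is the Euclidean norm and $\|\mathbf W\|_2$ the operator norm. The conjugate of a proper convex function $h$ is $h^*(\mathbf y)=\sup_{\mathbf x}\{\langle\mathbf y,\mathbf x\rangle-h(\mathbf x)\}\in\mathbb{R}\cup\{+\infty\}$. For a proper convex $\varphi:\mathbb{R}^m\to\mathbb{R}\cup\{+\infty\}$, $\operatorname{prox}_\varphi(\mathbf x)=\operatorname{argmin}_{\mathbf u}\{\frac12\|\mathbf u-\mathbf x\|^2+\varphi(\mathbf u)\}$. *)

theory Defs
  imports "HOL-Analysis.Analysis"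
begin

definition vec_map :: "('a \<Rightarrow> 'b) \<Rightarrow> 'a ^ 'n \<Rightarrow> 'b ^ 'n" where
  "vec_map s v = (\<chi> i. s (v $ i))"

(* The interval Lebesgue integral is oriented, so for a < 0 this is minus the integral
   over [a, 0]. *)
definition antideriv0 :: "(real \<Rightarrow> real) \<Rightarrow> real \<Rightarrow> real" where
  "antideriv0 s a = (LBINT t=0..ereal a. s t)"

definition proper_fun :: "('a \<Rightarrow> ereal) \<Rightarrow> bool" where
  "proper_fun h \<longleftrightarrow> (\<forall>x. h x \<noteq> -\<infinity>) \<and> (\<exists>x. h x \<noteq> \<infinity>)"

(* In ereal, 0 * \<infinity> = 0 and \<infinity> + (-\<infinity>) = \<infinity>, so this is convexity of the epigraph,
   for functions taking the value -\<infinity> as well. *)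
definition convex_ext :: "('a::real_vector \<Rightarrow> ereal) \<Rightarrow> bool" where
  "convex_ext h \<longleftrightarrow> (\<forall>x y t. 0 \<le> t \<and> t \<le> 1 \<longrightarrow>
     h ((1 - t) *\<^sub>R x + t *\<^sub>R y) \<le> ereal (1 - t) * h x + ereal t * h y)"

definition conjugate :: "('a::real_inner \<Rightarrow> ereal) \<Rightarrow> 'a \<Rightarrow> ereal" where
  "conjugate h y = (SUP x. ereal (y \<bullet> x) - h x)"

(* The set of all minimizers: the proximal point of x is p when prox h x = {p}. *)
definition prox :: "('a::real_inner \<Rightarrow> ereal) \<Rightarrow> 'a \<Rightarrow> 'a set" where
  "prox h x = {u. is_arg_min (\<lambda>u. ereal (1 / 2 * (norm (u - x))\<^sup>2) + h u) (\<lambda>_. True) u}"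

end

theory Submission
  imports Defs
begin

text \<open>
  The function \<open>\<psi>\<close> has gradient \<open>f\<close>, and the slope bounds on \<open>\<sigma>\<close> together with the bound on \<open>\<mu>\<close> give
  \<open>0 \<le> \<psi> y - \<psi> x - f x \<bullet> (y - x) \<le> (norm (y - x))\<^sup>2 / 2\<close>.
  The upper bound, tested at \<open>y = x + (u - f x)\<close>, improves the Fenchel inequality for \<open>\<psi>\<close> at \<open>u\<close>
  by the term \<open>(norm (u - f x))\<^sup>2 / 2\<close>. Subtracting \<open>(norm u)\<^sup>2 / 2\<close> cancels the quadratic
  part in \<open>u\<close>, so that \<open>\<phi>\<close> is a supremum of affine functions, hence convex. The objective
  of the proximal problem at \<open>z\<close> is \<open>\<psi>\<^sup>*(u) - u \<bullet> z\<close> up to a constant, so its minimizers are the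
  points where the improved inequality at \<open>z\<close> is tight, and this forces \<open>u = f z\<close>.
\<close>

text \<open>This serves both scalar bounds below: applied to a Taylor remainder it gives the lower
  one, applied to a parabola minus that remainder the upper one.\<close>

lemma ge_at_if_deriv_sign:
  fixes h h' :: "real \<Rightarrow> real"
  assumes deriv: "\<And>y. (h has_real_derivative h' y) (at y)"
    and sign: "\<And>y. 0 \<le> (y - a) * h' y"
  shows "h a \<le> h c"
proof (cases a c rule: linorder_cases)
  case less
  obtain z where z: "a < z" "z < c" "h c - h a = (c - a) * h' z"
    using MVT2[OF less, of h h'] deriv by blast
  have "0 \<le> h' z"
    using sign[of z] z by (simp add: zero_le_mult_iff)
  with z less show ?thesis
    by (smt (verit) mult_nonneg_nonneg)
next
  case greater
  obtain z where z: "c < z" "z < a" "h a - h c = (a - c) * h' z"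
    using MVT2[OF greater, of h h'] deriv by blast
  have "h' z \<le> 0"
    using sign[of z] z by (simp add: zero_le_mult_iff)
  with z greater show ?thesis
    by (smt (verit) mult_nonneg_nonpos)
qed simp

lemma has_real_derivative_antideriv0:
  assumes cont: "continuous_on UNIV s"
  shows "(antideriv0 s has_real_derivative s t) (at t)"
proof -
  \<comment> \<open>The fundamental theorem is stated on a compact interval; this radius puts the
    base point 0 inside it and \<open>t\<close> in its interior.\<close>
  define r where "r = \<bar>t\<bar> + 1"
  have "((\<lambda>u. LBINT y=0..ereal u. s y) has_vector_derivative s t) (at t within {-r..r})"
    using interval_integral_FTC2[of "-r" 0 r s t] continuous_on_subset[OF cont]
    by (simp add: r_def zero_ereal_def)
  moreover have "t \<in> interior {-r..r}"
    by (auto simp: r_def)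
  ultimately have "((\<lambda>u. LBINT y=0..ereal u. s y) has_vector_derivative s t) (at t)"
    using at_within_interior by metis
  then show ?thesis
    by (simp add: has_real_derivative_iff_has_vector_derivative antideriv0_def[abs_def])
qed

lemma antideriv0_bregman_bounds:
  fixes s :: "real \<Rightarrow> real"
  assumes slope: "\<And>p q. p \<noteq> q \<Longrightarrow> 0 \<le> (s p - s q) / (p - q) \<and> (s p - s q) / (p - q) \<le> L"
  shows "0 \<le> antideriv0 s c - antideriv0 s a - s a * (c - a)"
    and "antideriv0 s c - antideriv0 s a - s a * (c - a) \<le> L / 2 * (c - a)\<^sup>2"
proof -
  \<comment> \<open>Multiplying the slope bounds by the square of \<open>p - q\<close> removes the
    division and covers \<open>p = q\<close>. This is the form the sign conditions on the
    derivatives take.\<close>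
  have prod_bounds: "0 \<le> (p - q) * (s p - s q) \<and> (p - q) * (s p - s q) \<le> L * (p - q)\<^sup>2" for p q
  proof (cases "p = q")
    case False
    have "(p - q) * (s p - s q) = (s p - s q) / (p - q) * (p - q)\<^sup>2"
      using False by (simp add: power2_eq_square)
    with slope[OF False] show ?thesis
      by (metis mult_right_mono mult_nonneg_nonneg zero_le_power2)
  qed simp
  \<comment> \<open>This supplies the continuity that makes the antiderivative
    differentiable.\<close>
  have "L-lipschitz_on UNIV s"
  proof (rule lipschitz_onI)
    show "0 \<le> L"
      using slope[of 1 0] by simp
    show "dist (s p) (s q) \<le> L * dist p q" for p q
    proof (cases "p = q")
      case False
      then have "\<bar>s p - s q\<bar> / \<bar>p - q\<bar> \<le> L"
        using slope[OF False] by (simp flip: abs_divide)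
      with False show ?thesis
        by (simp add: dist_real_def divide_le_eq)
    qed simp
  qed
  then have deriv: "(antideriv0 s has_real_derivative s t) (at t)" for t
    by (intro has_real_derivative_antideriv0 lipschitz_on_continuous_on)
  define h where "h y = antideriv0 s y - antideriv0 s a - s a * (y - a)" for y
  have h_deriv: "(h has_real_derivative s y - s a) (at y)" for y
    unfolding h_def[abs_def] by (auto intro!: derivative_eq_intros deriv)
  have "h a \<le> h c"
    using h_deriv prod_bounds by (intro ge_at_if_deriv_sign[where h = h]) auto
  then show "0 \<le> antideriv0 s c - antideriv0 s a - s a * (c - a)"
    by (simp add: h_def)
  define k where "k y = L / 2 * (y - a)\<^sup>2 - h y" for y
  have "(k has_real_derivative L * (y - a) - (s y - s a)) (at y)" for y
    unfolding k_def[abs_def] by (auto intro!: derivative_eq_intros h_deriv)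
  moreover have "0 \<le> (y - a) * (L * (y - a) - (s y - s a))" for y
    using prod_bounds[of y a] by (simp add: algebra_simps power2_eq_square)
  ultimately have "k a \<le> k c"
    by (rule ge_at_if_deriv_sign)
  then show "antideriv0 s c - antideriv0 s a - s a * (c - a) \<le> L / 2 * (c - a)\<^sup>2"
    by (simp add: h_def k_def)
qed

text \<open>\<open>\<psi>\<close> is a separable sum composed with an affine map and
  \<open>f\<close> is its gradient by the chain rule, so its Bregman distance is a sum of scalar
  ones, one per coordinate of \<open>W *v z + c\<close>.\<close>

lemma ridge_bregman_bounds:
  fixes s :: "real \<Rightarrow> real" and W :: "real ^ 'm ^ 'n" and c :: "real ^ 'n"
    and f :: "real ^ 'm \<Rightarrow> real ^ 'm" and \<psi> :: "real ^ 'm \<Rightarrow> real"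
  assumes slope: "\<And>p q. p \<noteq> q \<Longrightarrow> 0 \<le> (s p - s q) / (p - q) \<and> (s p - s q) / (p - q) \<le> L"
    and \<mu>_pos: "\<mu> > 0"
    and f_eq: "\<And>z. f z = (1 / \<mu>) *\<^sub>R (transpose W *v vec_map s (W *v z + c))"
    and \<psi>_eq: "\<And>z. \<psi> z = (1 / \<mu>) * ((\<chi> i. 1) \<bullet> vec_map (antideriv0 s) (W *v z + c))"
    and \<mu>_ge: "\<mu> \<ge> L * (onorm ((*v) W))\<^sup>2"
  shows "0 \<le> \<psi> y - \<psi> x - f x \<bullet> (y - x)"
    and "\<psi> y - \<psi> x - f x \<bullet> (y - x) \<le> 1 / 2 * (norm (y - x))\<^sup>2"
proof -
  define D where "D i = antideriv0 s ((W *v y + c) $ i) - antideriv0 s ((W *v x + c) $ i)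
    - s ((W *v x + c) $ i) * ((W *v y + c) $ i - (W *v x + c) $ i)" for i
  have "f x \<bullet> (y - x) = 1 / \<mu> * (vec_map s (W *v x + c) \<bullet> (W *v (y - x)))"
    by (simp add: f_eq dot_lmul_matrix[symmetric])
  then have D_sum: "\<psi> y - \<psi> x - f x \<bullet> (y - x) = 1 / \<mu> * (\<Sum>i\<in>UNIV. D i)"
    by (simp add: \<psi>_eq D_def inner_vec_def vec_map_def sum_subtractf right_diff_distrib
        matrix_vector_mult_diff_distrib diff_divide_distrib)
  have "0 \<le> D i" for i
    unfolding D_def by (rule antideriv0_bregman_bounds[OF slope])
  with \<mu>_pos show "0 \<le> \<psi> y - \<psi> x - f x \<bullet> (y - x)"
    by (simp add: D_sum sum_nonneg)
  have "0 \<le> L"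
    using slope[of 1 0] by simp
  have "D i \<le> L / 2 * ((W *v (y - x)) $ i)\<^sup>2" for i
    using antideriv0_bregman_bounds(2)[OF slope, where c = "(W *v y + c) $ i" and a = "(W *v x + c) $ i"]
    by (simp add: D_def matrix_vector_mult_diff_distrib)
  then have "(\<Sum>i\<in>UNIV. D i) \<le> (\<Sum>i\<in>UNIV. L / 2 * ((W *v (y - x)) $ i)\<^sup>2)"
    by (rule sum_mono)
  also have "\<dots> = L / 2 * (norm (W *v (y - x)))\<^sup>2"
    unfolding power2_norm_eq_inner inner_vec_def by (simp add: sum_distrib_left power2_eq_square)
  also have "\<dots> \<le> L / 2 * (onorm ((*v) W) * norm (y - x))\<^sup>2"
    using \<open>0 \<le> L\<close> by (intro mult_left_mono power_mono onorm) auto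
  also have "\<dots> = L * (onorm ((*v) W))\<^sup>2 * (1 / 2 * (norm (y - x))\<^sup>2)"
    by (simp add: power_mult_distrib)
  \<comment> \<open>The bound on \<open>\<mu>\<close> enters here; the factor
    \<open>1 / \<mu>\<close> in \<open>\<psi>\<close> then cancels \<open>\<mu>\<close>.\<close>
  also have "\<dots> \<le> \<mu> * (1 / 2 * (norm (y - x))\<^sup>2)"
    using \<mu>_ge by (intro mult_right_mono) auto
  finally show "\<psi> y - \<psi> x - f x \<bullet> (y - x) \<le> 1 / 2 * (norm (y - x))\<^sup>2"
    unfolding D_sum using \<mu>_pos by (simp add: field_simps)
qed

lemma conjugate_ereal_ge: "ereal (u \<bullet> v - \<psi> v) \<le> conjugate (\<lambda>v. ereal (\<psi> v)) u"
  unfolding conjugate_def by (rule SUP_upper2[of v]) auto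

text \<open>The equality case of the Fenchel inequality: for a subgradient \<open>p\<close> at
  \<open>z\<close>, the supremum is attained at \<open>z\<close>.\<close>

lemma conjugate_at_subgradient:
  assumes "\<And>y. 0 \<le> \<psi> y - \<psi> z - p \<bullet> (y - z)"
  shows "conjugate (\<lambda>v. ereal (\<psi> v)) p = ereal (p \<bullet> z - \<psi> z)"
proof (rule antisym[OF _ conjugate_ereal_ge])
  have "p \<bullet> y - \<psi> y \<le> p \<bullet> z - \<psi> z" for y
    using assms[of y] by (simp add: inner_diff_right)
  then show "conjugate (\<lambda>v. ereal (\<psi> v)) p \<le> ereal (p \<bullet> z - \<psi> z)"
    unfolding conjugate_def by (intro SUP_least) simp
qed

lemma conjugate_smooth_ge:
  assumes "\<And>y. \<psi> y - \<psi> z - p \<bullet> (y - z) \<le> 1 / 2 * (norm (y - z))\<^sup>2"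
  shows "ereal (u \<bullet> z - \<psi> z + 1 / 2 * (norm (u - p))\<^sup>2) \<le> conjugate (\<lambda>v. ereal (\<psi> v)) u"
proof -
  \<comment> \<open>The assumption bounds \<open>u \<bullet> y - \<psi> y\<close> from below by a
    concave quadratic in \<open>y\<close>; \<open>z + (u - p)\<close> is its maximizer.\<close>
  have "u \<bullet> z - \<psi> z + 1 / 2 * (norm (u - p))\<^sup>2 \<le> u \<bullet> (z + (u - p)) - \<psi> (z + (u - p))"
    using assms[of "z + (u - p)"]
    by (simp add: power2_norm_eq_inner inner_add_right inner_diff_left inner_diff_right inner_commute
        field_simps)
  then show ?thesis
    using conjugate_ereal_ge[of u "z + (u - p)" \<psi>] by (meson ereal_less_eq(3) order_trans)
qed

lemma convex_ext_SUP_affine: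
  fixes a :: "'i \<Rightarrow> 'a::real_inner" and c :: "'i \<Rightarrow> real"
  shows "convex_ext (\<lambda>u. SUP i. ereal (a i \<bullet> u + c i))"
  unfolding convex_ext_def
proof (intro allI impI SUP_least)
  fix u v :: 'a and t :: real and i
  assume t: "0 \<le> t \<and> t \<le> 1"
  let ?g = "\<lambda>u. SUP i. ereal (a i \<bullet> u + c i)"
  have "ereal (a i \<bullet> ((1 - t) *\<^sub>R u + t *\<^sub>R v) + c i)
      = ereal (1 - t) * ereal (a i \<bullet> u + c i) + ereal t * ereal (a i \<bullet> v + c i)"
    by (simp add: algebra_simps)
  also have "\<dots> \<le> ereal (1 - t) * ?g u + ereal t * ?g v"
    using t by (intro add_mono ereal_mult_left_mono SUP_upper) auto
  finally show "ereal (a i \<bullet> ((1 - t) *\<^sub>R u + t *\<^sub>R v) + c i)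
      \<le> ereal (1 - t) * ?g u + ereal t * ?g v" .
qed

lemma prox_conjugate_minus_square:
  fixes f :: "'a::real_inner \<Rightarrow> 'a" and \<psi> :: "'a \<Rightarrow> real" and \<phi> :: "'a \<Rightarrow> ereal"
  assumes subgrad: "\<And>x y. 0 \<le> \<psi> y - \<psi> x - f x \<bullet> (y - x)"
    and smooth: "\<And>x y. \<psi> y - \<psi> x - f x \<bullet> (y - x) \<le> 1 / 2 * (norm (y - x))\<^sup>2"
    and \<phi>_eq: "\<And>z. \<phi> z = conjugate (\<lambda>v. ereal (\<psi> v)) z - ereal (1 / 2 * (norm z)\<^sup>2)"
  shows "proper_fun \<phi>" "convex_ext \<phi>" "prox \<phi> z = {f z}"
    and "z = f z \<Longrightarrow> is_arg_min \<phi> (\<lambda>_. True) z"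
proof -
  \<comment> \<open>An affine minorant of \<open>\<phi>\<close> with slope \<open>z - f z\<close>,
    touching \<open>\<phi>\<close> at \<open>f z\<close>.\<close>
  let ?aff = "\<lambda>z u. (z - f z) \<bullet> u + (1 / 2 * (norm (f z))\<^sup>2 - \<psi> z)"
  have aff_eq: "?aff z u = u \<bullet> z - \<psi> z + 1 / 2 * (norm (u - f z))\<^sup>2 - 1 / 2 * (norm u)\<^sup>2" for z u
    by (simp add: power2_norm_eq_inner inner_commute algebra_simps)
  have \<phi>_ge: "ereal (?aff z u) \<le> \<phi> u" for z u
    using ereal_minus_mono[OF conjugate_smooth_ge[OF smooth, of u z] order_refl, of "ereal (1 / 2 * (norm u)\<^sup>2)"]
    unfolding aff_eq \<phi>_eq by simp
  have \<phi>_f: "\<phi> (f z) = ereal (f z \<bullet> z - \<psi> z - 1 / 2 * (norm (f z))\<^sup>2)" for z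
    by (simp add: \<phi>_eq conjugate_at_subgradient[OF subgrad])
  have \<phi>_SUP: "\<phi> u = (SUP z. ereal (?aff z u))" for u
  proof (rule antisym)
    \<comment> \<open>Dropping the nonnegative term \<open>1 / 2 * (norm (u - f z))\<^sup>2\<close>
      from \<open>aff_eq\<close> leaves the plain Fenchel terms, so the minorants already exhaust
      the supremum.\<close>
    have "conjugate (\<lambda>v. ereal (\<psi> v)) u \<le> (SUP z. ereal (?aff z u)) + ereal (1 / 2 * (norm u)\<^sup>2)"
      unfolding conjugate_def
    proof (rule SUP_least)
      fix z
      have "ereal (u \<bullet> z) - ereal (\<psi> z) \<le> ereal (?aff z u) + ereal (1 / 2 * (norm u)\<^sup>2)"
        unfolding aff_eq by simp
      also have "\<dots> \<le> (SUP z. ereal (?aff z u)) + ereal (1 / 2 * (norm u)\<^sup>2)"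
        by (intro add_right_mono SUP_upper) simp
      finally show "ereal (u \<bullet> z) - ereal (\<psi> z) \<le> \<dots>" .
    qed
    then show "\<phi> u \<le> (SUP z. ereal (?aff z u))"
      unfolding \<phi>_eq by (subst ereal_minus_le) auto
    show "(SUP z. ereal (?aff z u)) \<le> \<phi> u"
      by (intro SUP_least \<phi>_ge)
  qed
  show "convex_ext \<phi>"
    unfolding \<phi>_SUP[abs_def] by (rule convex_ext_SUP_affine)
  show "proper_fun \<phi>"
    unfolding proper_fun_def
  proof (intro conjI allI exI)
    show "\<phi> u \<noteq> -\<infinity>" for u
      using \<phi>_ge[of u u] by auto
    show "\<phi> (f 0) \<noteq> \<infinity>"
      by (simp add: \<phi>_f)
  qed
  show "prox \<phi> z = {f z}"
  proof -
    let ?J = "\<lambda>u. ereal (1 / 2 * (norm (u - z))\<^sup>2) + \<phi> u"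
    \<comment> \<open>The minimal value of the proximal objective, that is, the Moreau envelope of
      \<open>\<phi>\<close> at \<open>z\<close>.\<close>
    let ?m = "1 / 2 * (norm z)\<^sup>2 - \<psi> z"
    have J_f: "?J (f z) = ereal ?m"
      by (simp add: \<phi>_f power2_norm_eq_inner inner_diff_left inner_diff_right inner_commute field_simps)
    \<comment> \<open>The quadratic excess over \<open>?m\<close> makes the minimizer
      unique.\<close>
    have J_ge: "ereal (?m + 1 / 2 * (norm (u - f z))\<^sup>2) \<le> ?J u" for u
    proof -
      have "?m + 1 / 2 * (norm (u - f z))\<^sup>2 = 1 / 2 * (norm (u - z))\<^sup>2 + ?aff z u"
        unfolding aff_eq
        by (simp add: power2_norm_eq_inner inner_diff_left inner_diff_right inner_commute field_simps)
      then have "ereal (?m + 1 / 2 * (norm (u - f z))\<^sup>2)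
          = ereal (1 / 2 * (norm (u - z))\<^sup>2) + ereal (?aff z u)"
        by simp
      also have "\<dots> \<le> ?J u"
        by (intro add_left_mono \<phi>_ge)
      finally show ?thesis .
    qed
    have "?J (f z) \<le> ?J u" for u
      unfolding J_f by (rule order_trans[OF _ J_ge]) simp
    moreover have "?J (f z) < ?J u" if "u \<noteq> f z" for u
      unfolding J_f by (rule less_le_trans[OF _ J_ge]) (use that in simp)
    ultimately show ?thesis
      unfolding prox_def is_arg_min_def by (auto simp: not_less) (meson leD)
  qed
  assume fixed: "z = f z"
  \<comment> \<open>At a fixed point the slope \<open>z - f z\<close> vanishes, so the minorant is
    the constant \<open>\<phi> z\<close>.\<close>
  have "\<phi> z \<le> \<phi> u" for u
  proof -
    have "\<phi> z = ereal (?aff z u)"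
      using \<phi>_f[of z] fixed by (simp add: power2_norm_eq_inner)
    then show ?thesis
      using \<phi>_ge[of z u] by simp
  qed
  then show "is_arg_min \<phi> (\<lambda>_. True) z"
    by (auto simp: is_arg_min_def not_less)
qed

theorem theorem1:
  fixes \<sigma> :: "real \<Rightarrow> real" and L \<mu> :: real
    and W :: "real ^ 'm ^ 'n" and U :: "real ^ 'd ^ 'n"
    and b :: "real ^ 'n" and x :: "real ^ 'd"
    and f :: "real ^ 'm \<Rightarrow> real ^ 'm"
    and \<psi> :: "real ^ 'm \<Rightarrow> real"
    and \<phi> :: "real ^ 'm \<Rightarrow> ereal"
  assumes \<sigma>: "\<And>s t. s \<noteq> t \<Longrightarrow> 0 \<le> (\<sigma> s - \<sigma> t) / (s - t) \<and> (\<sigma> s - \<sigma> t) / (s - t) \<le> L"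
    and \<mu>_pos: "\<mu> > 0"
    and f_eq: "\<And>z. f z = (1 / \<mu>) *\<^sub>R (transpose W *v vec_map \<sigma> (W *v z + U *v x + b))"
    and \<psi>_eq: "\<And>z. \<psi> z = (1 / \<mu>) * ((\<chi> i. 1) \<bullet> vec_map (antideriv0 \<sigma>) (W *v z + U *v x + b))"
    and \<phi>_eq: "\<And>z. \<phi> z = conjugate (\<lambda>v. ereal (\<psi> v)) z - ereal (1 / 2 * (norm z)\<^sup>2)"
    and \<mu>_ge: "\<mu> \<ge> L * (onorm (\<lambda>v. W *v v))\<^sup>2"
  shows "proper_fun \<phi> \<and> convex_ext \<phi>
    \<and> (\<forall>z. prox \<phi> z = {f z})
    \<and> (\<forall>z. z = f z \<longrightarrow> is_arg_min \<phi> (\<lambda>_. True) z)"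
proof -
  \<comment> \<open>Regrouping makes \<open>U *v x + b\<close> the single offset \<open>c\<close> of
    the ridge bounds.\<close>
  have f_eq': "f z = (1 / \<mu>) *\<^sub>R (transpose W *v vec_map \<sigma> (W *v z + (U *v x + b)))"
    and \<psi>_eq': "\<psi> z = (1 / \<mu>) * ((\<chi> i. 1) \<bullet> vec_map (antideriv0 \<sigma>) (W *v z + (U *v x + b)))" for z
    by (simp_all add: f_eq \<psi>_eq add.assoc)
  note bregman = ridge_bregman_bounds[OF \<sigma> \<mu>_pos f_eq' \<psi>_eq' \<mu>_ge]
  note prox = prox_conjugate_minus_square[OF bregman \<phi>_eq]
  from prox show ?thesis
    by blast
qed

end
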